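(* Let $m$ and $n$ be positive integers, let $\mathbb{Z}_{m\times n}$ be the $m\times n$ rectangular grid graph, and let $P_{m\times n}(z)=\sum_t k(t)\,z^t$, where $k(t)$ is the number of maximal independent sets of $\mathbb{Z}_{m\times n}$ consisting of exactly $t$ vertices. Define $3^k\times 3^k$ matrices $A_k,B_k,C_k$ with entries in $\mathbb{Z}[z]$ by $$A_0=\begin{bmatrix}0\end{bmatrix},\qquad B_0=C_0=\begin{bmatrix}1\end{bmatrix},$$ and, for $k=0,\dots,m-1$, by the $3\times 3$ block formulas $$A_{k+1}=\begin{bmatrix}\mathbb{O}_k&\mathbb{O}_k&z\,C_k\\ \mathbb{O}_k&\mathbb{O}_k&\mathbb{O}_k\\ \mathbb{O}_k&\mathbb{O}_k&\mathbb{O}_k\end{bmatrix},\qquad B_{k+1}=\begin{bmatrix}\mathbb{O}_k&\mathbb{O}_k&\mathbb{O}_k\\ A_k+B_k&A_k&\mathbb{O}_k\\ A_k+B_k&A_k+B_k&\mathbb{O}_k\end{bmatrix},$$ $$C_{k+1}=\begin{bmatrix}\mathbb{O}_k&\mathbb{O}_k&\mathbb{O}_k\\ A_k+B_k&A_k+B_k&\mathbb{O}_k\\ A_k+B_k&A_k+B_k&\mathbb{O}_k\end{bmatrix}.$$ Let $D_m=\ \stackrel{m}{\otimes}\begin{bmatrix}1&1&0\end{bmatrix}$ (a $1\times 3^m$ matrix) and $E_m=\ \stackrel{m}{\otimes}\begin{bmatrix}0\\1\\1\end{bmatrix}$ (a $3^m\times 1$ matrix). Then $P_{m\times n}(z)$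 is the unique entry of the $1\times 1$ matrix $$D_m\cdot(A_m+B_m)^n\cdot E_m.$$
   Context: The grid graph $\mathbb{Z}_{m\times n}$ has vertex set $\{1,\dots,m\}\times\{1,\dots,n\}$, with two vertices adjacent iff they are horizontal or vertical nearest neighbours (i.e. they differ by exactly $1$ in one coordinate and agree in the other). An independent vertex set is a set of vertices no two of which are adjacent; a maximal independent set (MIS) is an independent vertex set that is not a proper subset of any other independent vertex set. $\mathbb{O}_k$ denotes the $3^k\times 3^k$ zero matrix. $\stackrel{m}{\otimes}A$ denotes the $m$-fold tensor (Kronecker) product of the matrix $A$ with itself, where the Kronecker product $A\otimes B$ is the block matrix whose $(i,j)$ block is $a_{ij}B$. *)

theory Defs
  imports
    "Jordan_Normal_Form.Matrix"
    "Graph_Theory.Pair_Digraph"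
    "HOL-Computational_Algebra.Polynomial"
begin

text \<open>
  Simple graphs are represented as in \<^theory>\<open>Graph_Theory.Pair_Digraph\<close>, where an undirected edge
  is a pair of opposite arcs; \<^locale>\<open>pair_graph\<close> characterises the finite, loop-free, symmetric ones.
\<close>

definition grid_graph :: "nat \<Rightarrow> nat \<Rightarrow> (nat \<times> nat) pair_pre_digraph" where
  "grid_graph m n =
    \<lparr> pverts = {1..m} \<times> {1..n},
      parcs = {((i, j), (k, l)) | i j k l.
        (i, j) \<in> {1..m} \<times> {1..n} \<and> (k, l) \<in> {1..m} \<times> {1..n} \<and>
        (i = k \<and> \<bar>int j - int l\<bar> = 1 \<or> j = l \<and> \<bar>int i - int k\<bar> = 1)} \<rparr>"

lemma pair_graph_grid_graph: "pair_graph (grid_graph m n)"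
proof
  show "finite (pverts (grid_graph m n))"
    by (simp add: grid_graph_def)
  have "parcs (grid_graph m n) \<subseteq> pverts (grid_graph m n) \<times> pverts (grid_graph m n)"
    by (auto simp: grid_graph_def)
  then show "finite (parcs (grid_graph m n))"
    by (rule finite_subset) (simp add: grid_graph_def)
  show "symmetric (grid_graph m n)"
    by (auto simp: grid_graph_def symmetric_def arcs_ends_def arc_to_ends_def intro!: symI)
qed (auto simp: grid_graph_def)

definition independent_vset :: "'a pair_pre_digraph \<Rightarrow> 'a set \<Rightarrow> bool" where
  "independent_vset G S \<longleftrightarrow> S \<subseteq> pverts G \<and> (\<forall>u\<in>S. \<forall>v\<in>S. (u, v) \<notin> parcs G)"

definition maximal_independent_vset :: "'a pair_pre_digraph \<Rightarrow> 'a set \<Rightarrow> bool" where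
  "maximal_independent_vset G S \<longleftrightarrow>
    independent_vset G S \<and> \<not> (\<exists>T. independent_vset G T \<and> S \<subset> T)"

definition mis_count :: "nat \<Rightarrow> nat \<Rightarrow> nat \<Rightarrow> nat" where
  "mis_count m n t = card {S. maximal_independent_vset (grid_graph m n) S \<and> card S = t}"

text \<open>
  No set of vertices has more than \<open>m * n\<close> elements, so the bound on \<open>t\<close> cuts off nothing;
  see \<open>coeff_mis_poly\<close>.
\<close>

definition mis_poly :: "nat \<Rightarrow> nat \<Rightarrow> int poly" where
  "mis_poly m n = (\<Sum>t\<le>m * n. monom (int (mis_count m n t)) t)"

lemma mis_count_eq_0:
  assumes "m * n < t"
  shows "mis_count m n t = 0"
proof -
  have "card S \<le> m * n" if "maximal_independent_vset (grid_graph m n) S" for S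
    using that card_mono[of "{1..m} \<times> {1..n}" S]
    by (auto simp: maximal_independent_vset_def independent_vset_def grid_graph_def)
  with assms have "{S. maximal_independent_vset (grid_graph m n) S \<and> card S = t} = {}"
    by fastforce
  then show ?thesis
    unfolding mis_count_def by (simp only: card.empty)
qed

lemma coeff_mis_poly: "coeff (mis_poly m n) t = int (mis_count m n t)"
  by (cases "t \<le> m * n") (auto simp: mis_poly_def coeff_sum mis_count_eq_0)

definition kronecker_product :: "'a::times mat \<Rightarrow> 'a mat \<Rightarrow> 'a mat" (infixr \<open>\<otimes>\<^sub>m\<close> 72) where
  "A \<otimes>\<^sub>m B = mat (dim_row A * dim_row B) (dim_col A * dim_col B)
    (\<lambda>(i, j). A $$ (i div dim_row B, j div dim_col B) * B $$ (i mod dim_row B, j mod dim_col B))"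

fun kronecker_power :: "nat \<Rightarrow> 'a::semiring_1 mat \<Rightarrow> 'a mat" where
  "kronecker_power 0 A = 1\<^sub>m 1"
| "kronecker_power (Suc m) A = A \<otimes>\<^sub>m kronecker_power m A"

lemma kronecker_power_1: "kronecker_power 1 A = A"
  by (auto simp: kronecker_product_def)

text \<open>The \<open>3 \<times> 3\<close> block matrix with \<open>N \<times> N\<close> blocks, given as a list of block rows.\<close>

definition block3_mat :: "nat \<Rightarrow> 'a mat list list \<Rightarrow> 'a mat" where
  "block3_mat N Bs = mat (3 * N) (3 * N)
    (\<lambda>(i, j). (Bs ! (i div N) ! (j div N)) $$ (i mod N, j mod N))"

abbreviation zero_block :: "nat \<Rightarrow> int poly mat" (\<open>\<bbbO>\<close>) where
  "\<bbbO> k \<equiv> 0\<^sub>m (3 ^ k) (3 ^ k)"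

fun A_mat :: "nat \<Rightarrow> int poly mat"
  and B_mat :: "nat \<Rightarrow> int poly mat"
  and C_mat :: "nat \<Rightarrow> int poly mat" where
  "A_mat 0 = mat_of_rows_list 1 [[0]]"
| "A_mat (Suc k) = block3_mat (3 ^ k)
    [[\<bbbO> k, \<bbbO> k, [:0, 1:] \<cdot>\<^sub>m C_mat k],
     [\<bbbO> k, \<bbbO> k, \<bbbO> k],
     [\<bbbO> k, \<bbbO> k, \<bbbO> k]]"
| "B_mat 0 = mat_of_rows_list 1 [[1]]"
| "B_mat (Suc k) = block3_mat (3 ^ k)
    [[\<bbbO> k, \<bbbO> k, \<bbbO> k],
     [A_mat k + B_mat k, A_mat k, \<bbbO> k],
     [A_mat k + B_mat k, A_mat k + B_mat k, \<bbbO> k]]"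
| "C_mat 0 = mat_of_rows_list 1 [[1]]"
| "C_mat (Suc k) = block3_mat (3 ^ k)
    [[\<bbbO> k, \<bbbO> k, \<bbbO> k],
     [A_mat k + B_mat k, A_mat k + B_mat k, \<bbbO> k],
     [A_mat k + B_mat k, A_mat k + B_mat k, \<bbbO> k]]"

definition D_mat :: "nat \<Rightarrow> int poly mat" where
  "D_mat m = kronecker_power m (mat_of_rows_list 3 [[1, 1, 0]])"

definition E_mat :: "nat \<Rightarrow> int poly mat" where
  "E_mat m = kronecker_power m (mat_of_rows_list 1 [[0], [1], [1]])"

end

theory Submission
  imports Defs
begin

text \<open>
  This is the transfer-matrix method, run along the columns of the grid.  A set of vertices is the
  sequence of its columns \<open>F 1, \<dots>, F n\<close>, each a subset of \<open>{1..m}\<close>; put \<open>F 0 = F (n + 1) = {}\<close>.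
  The set is independent and dominating, which for a graph means maximal independent, iff
  neighbouring columns are disjoint and each triple \<open>F (j - 1), F j, F (j + 1)\<close> passes a test that
  looks at the middle column only: no two vertical neighbours are selected, and each
  unselected cell has a selected neighbour.  So it suffices to remember two consecutive columns.

  The index \<open>{0..<3 ^ m}\<close> is precisely the set of such memories.  For disjoint \<open>P, Q \<subseteq> {1..m}\<close>, the
  columns left and right of a vertical cut, the ternary digit of row \<open>r\<close> is \<open>0\<close> if \<open>r \<in> Q\<close>, \<open>2\<close> if
  \<open>r \<in> P\<close>, and \<open>1\<close> otherwise (\<open>bij_betw_interface_code\<close>).  Under this renaming the
  matrices have a plain meaning.  The entry of \<open>A_mat m + B_mat m\<close> at row \<open>(P, Q)\<close> and column \<open>(Q', R)\<close>
  is \<open>z ^ card Q\<close> if \<open>Q = Q'\<close> and the triple \<open>P, Q, R\<close> passes the test, and \<open>0\<close> otherwise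
  (\<open>transfer_mat_interface_code\<close>); \<open>D_mat m\<close> is the indicator of \<open>P = {}\<close>, and \<open>E_mat m\<close> that of
  \<open>Q = {}\<close>.  The recursion for \<open>A\<close>, \<open>B\<close>, \<open>C\<close> builds a column of the grid row by row: \<open>A_mat k\<close>
  treats the rows \<open>1..k\<close> when row \<open>k\<close> is selected, \<open>B_mat k\<close> when neither row \<open>k\<close> nor row \<open>k + 1\<close>
  is, and \<open>C_mat k\<close> when row \<open>k + 1\<close> is selected (\<open>ABC_mat_interface_code\<close>).

  Multiplying by the transfer matrix therefore appends one column to every admissible sequence, so
  the matrix product sums \<open>z\<close> to the number of selected cells over all admissible sequences that
  begin and end with an empty column (\<open>transfer_product_eq_sum\<close>).  These sequences are the maximal
  independent sets (\<open>bij_betw_admissible_mis\<close>).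
\<close>

section \<open>Ternary codes of pairs of columns\<close>

fun interface_code :: "nat \<Rightarrow> nat set \<Rightarrow> nat set \<Rightarrow> nat" where
  "interface_code 0 P Q = 0"
| "interface_code (Suc k) P Q =
    (if Suc k \<in> Q then 0 else if Suc k \<in> P then 2 else 1) * 3 ^ k + interface_code k P Q"

text \<open>
  Two neighbouring columns of an independent set cannot share a row.  Disjointness is also what makes
  the three digits exhaust the possibilities for a row.
\<close>
definition interfaces :: "nat \<Rightarrow> (nat set \<times> nat set) set" where
  "interfaces m = {(P, Q). P \<subseteq> {1..m} \<and> Q \<subseteq> {1..m} \<and> P \<inter> Q = {}}"

lemma finite_interfaces: "finite (interfaces m)"
  by (rule finite_subset[of _ "Pow {1..m} \<times> Pow {1..m}"]) (auto simp: interfaces_def)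

lemma interface_code_less: "interface_code k P Q < 3 ^ k"
  by (induction k) auto

lemma interface_code_div:
  "interface_code (Suc k) P Q div 3 ^ k = (if Suc k \<in> Q then 0 else if Suc k \<in> P then 2 else 1)"
  using interface_code_less[of k P Q] by simp

lemma interface_code_mod: "interface_code (Suc k) P Q mod 3 ^ k = interface_code k P Q"
  using interface_code_less[of k P Q] by simp

lemma interface_code_cong:
  assumes "P \<inter> {1..k} = P' \<inter> {1..k}" "Q \<inter> {1..k} = Q' \<inter> {1..k}"
  shows "interface_code k P Q = interface_code k P' Q'"
  using assms
proof (induction k)
  case (Suc k)
  have "P \<inter> {1..k} = P' \<inter> {1..k}" "Q \<inter> {1..k} = Q' \<inter> {1..k}"
    "Suc k \<in> P \<longleftrightarrow> Suc k \<in> P'" "Suc k \<in> Q \<longleftrightarrow> Suc k \<in> Q'"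
    using Suc.prems by (fastforce simp: set_eq_iff)+
  with Suc.IH show ?case by simp
qed simp

lemma interface_code_inject:
  assumes "interface_code k P Q = interface_code k P' Q'" "P \<inter> Q = {}" "P' \<inter> Q' = {}"
    and "r \<in> {1..k}"
  shows "(r \<in> P \<longleftrightarrow> r \<in> P') \<and> (r \<in> Q \<longleftrightarrow> r \<in> Q')"
  using assms
proof (induction k)
  case (Suc k)
  have "interface_code k P Q = interface_code k P' Q'"
    using Suc.prems(1) interface_code_mod by metis
  moreover have "(Suc k \<in> P \<longleftrightarrow> Suc k \<in> P') \<and> (Suc k \<in> Q \<longleftrightarrow> Suc k \<in> Q')"
    using arg_cong[OF Suc.prems(1), of "\<lambda>i. i div 3 ^ k"] Suc.prems(2,3)
    unfolding interface_code_div by (auto split: if_splits)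
  ultimately show ?case
    using Suc.IH Suc.prems(2-4) by (cases "r = Suc k") auto
qed simp

lemma interface_code_surj:
  assumes "i < 3 ^ k"
  shows "\<exists>(P, Q) \<in> interfaces k. interface_code k P Q = i"
  using assms
proof (induction k arbitrary: i)
  case 0
  then show ?case by (auto simp: interfaces_def)
next
  case (Suc k)
  have "i mod 3 ^ k < 3 ^ k" by simp
  from Suc.IH[OF this] obtain P Q
    where PQ: "(P, Q) \<in> interfaces k" and code: "interface_code k P Q = i mod 3 ^ k" by auto
  have "i div 3 ^ k < 3"
    using Suc.prems by (simp add: less_mult_imp_div_less)
  then consider "i div 3 ^ k = 0" | "i div 3 ^ k = 1" | "i div 3 ^ k = 2" by linarith
  \<comment> \<open>the leading digit decides where row \<open>k + 1\<close> goes: right, nowhere, or left\<close>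
  then obtain P' Q' where ext: "(P', Q') \<in> interfaces (Suc k)" "P' \<inter> {1..k} = P \<inter> {1..k}"
    "Q' \<inter> {1..k} = Q \<inter> {1..k}"
    "(if Suc k \<in> Q' then 0 else if Suc k \<in> P' then 2 else 1) = i div 3 ^ k"
  proof cases
    case 1
    with PQ show ?thesis
      by (intro that[of P "insert (Suc k) Q"]) (force simp: interfaces_def)+
  next
    case 2
    with PQ show ?thesis
      by (intro that[of P Q]) (force simp: interfaces_def)+
  next
    case 3
    with PQ show ?thesis
      by (intro that[of "insert (Suc k) P" Q]) (force simp: interfaces_def)+
  qed
  have "interface_code (Suc k) P' Q' = i div 3 ^ k * 3 ^ k + i mod 3 ^ k"
    using ext(4) interface_code_cong[OF ext(2,3)] code by simp
  then have "interface_code (Suc k) P' Q' = i"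
    by (simp only: div_mult_mod_eq)
  with ext(1) show ?case by (intro bexI[of _ "(P', Q')"]) (simp del: interface_code.simps)
qed

lemma bij_betw_interface_code:
  "bij_betw (\<lambda>(P, Q). interface_code m P Q) (interfaces m) {0..<3 ^ m}"
proof (rule bij_betw_imageI)
  show "inj_on (\<lambda>(P, Q). interface_code m P Q) (interfaces m)"
  proof (rule inj_onI, clarify)
    fix P Q P' Q'
    assume *: "(P, Q) \<in> interfaces m" "(P', Q') \<in> interfaces m"
      "interface_code m P Q = interface_code m P' Q'"
    then have sub: "P \<subseteq> {1..m}" "P' \<subseteq> {1..m}" "Q \<subseteq> {1..m}" "Q' \<subseteq> {1..m}"
      and disj: "P \<inter> Q = {}" "P' \<inter> Q' = {}"
      by (auto simp: interfaces_def)
    from interface_code_inject[OF *(3) disj]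
    have "\<And>r. r \<in> {1..m} \<Longrightarrow> (r \<in> P \<longleftrightarrow> r \<in> P') \<and> (r \<in> Q \<longleftrightarrow> r \<in> Q')" .
    with sub show "P = P' \<and> Q = Q'" by blast
  qed
  show "(\<lambda>(P, Q). interface_code m P Q) ` interfaces m = {0..<3 ^ m}"
    using interface_code_surj[of _ m] by (fastforce simp: interface_code_less image_iff)
qed

section \<open>Meaning of the entries of the matrices\<close>

text \<open>
  The test on the middle column \<open>Q\<close>, between \<open>P\<close> and \<open>R\<close>, for the rows \<open>1..k\<close>.  The set \<open>Q\<close> may contain
  \<open>k + 1\<close>: a row outside the range can still exclude or dominate row \<open>k\<close>, and the
  recursion over \<open>k\<close> depends on that.  For row \<open>1\<close> the clause \<open>r - 1 \<in> Q\<close> is void only when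
  \<open>0 \<notin> Q\<close>.
\<close>
definition column_ok :: "nat \<Rightarrow> nat set \<Rightarrow> nat set \<Rightarrow> nat set \<Rightarrow> bool" where
  "column_ok k P Q R \<longleftrightarrow> (\<forall>r\<in>{1..k}.
    if r \<in> Q then Suc r \<notin> Q else r \<in> P \<or> r \<in> R \<or> r - 1 \<in> Q \<or> Suc r \<in> Q)"

lemma column_ok_Suc:
  "column_ok (Suc k) P Q R \<longleftrightarrow> column_ok k P Q R \<and>
    (if Suc k \<in> Q then Suc (Suc k) \<notin> Q
     else Suc k \<in> P \<or> Suc k \<in> R \<or> k \<in> Q \<or> Suc (Suc k) \<in> Q)"
  by (auto simp: column_ok_def atLeastAtMostSuc_conv)

text \<open>
  The common value of the entries of \<open>A_mat k\<close>, \<open>B_mat k\<close> and \<open>C_mat k\<close> that do not vanish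
  because of rows \<open>k\<close> and \<open>k + 1\<close>.  The row index describes the cut \<open>(P, Q)\<close> to the left of the column
  and the column index the cut \<open>(Q', R)\<close> to its right; the two must agree on the column itself.
\<close>
definition column_weight ::
  "nat \<Rightarrow> nat set \<Rightarrow> nat set \<Rightarrow> nat set \<Rightarrow> nat set \<Rightarrow> int poly" where
  "column_weight k P Q Q' R =
    (if Q \<inter> {1..k} = Q' \<inter> {1..k} \<and> column_ok k P Q R then monom 1 (card (Q \<inter> {1..k})) else 0)"

lemma column_weight_0: "column_weight 0 P Q Q' R = 1"
  by (simp add: column_weight_def column_ok_def)

lemma column_weight_Suc:
  "column_weight (Suc k) P Q Q' R =
    (if Suc k \<in> Q then
       if Suc k \<in> Q' \<and> Suc (Suc k) \<notin> Q then [:0, 1:] * column_weight k P Q Q' R else 0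
     else if Suc k \<notin> Q' \<and> (Suc k \<in> P \<or> Suc k \<in> R \<or> k \<in> Q \<or> Suc (Suc k) \<in> Q)
       then column_weight k P Q Q' R else 0)"
proof -
  have card: "card (Q \<inter> {1..Suc k}) =
      (if Suc k \<in> Q then Suc (card (Q \<inter> {1..k})) else card (Q \<inter> {1..k}))"
  proof -
    have "Q \<inter> {1..Suc k} =
        (if Suc k \<in> Q then insert (Suc k) (Q \<inter> {1..k}) else Q \<inter> {1..k})"
      by (auto simp: atLeastAtMostSuc_conv)
    then show ?thesis by simp
  qed
  have agree: "Q \<inter> {1..Suc k} = Q' \<inter> {1..Suc k} \<longleftrightarrow>
      (Suc k \<in> Q \<longleftrightarrow> Suc k \<in> Q') \<and> Q \<inter> {1..k} = Q' \<inter> {1..k}"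
    by (auto simp: set_eq_iff le_Suc_eq)
  \<comment> \<open>kept opaque, since multiplication by \<open>[:0, 1:]\<close> would be rewritten to \<open>pCons\<close> form\<close>
  define z where "z = [:0, 1 :: int:]"
  have monom: "monom 1 (Suc d) = z * monom 1 d" for d
    by (simp add: monom_Suc z_def)
  show ?thesis
    unfolding column_weight_def agree column_ok_Suc card z_def[symmetric]
    by (simp add: monom)
qed

lemma block3_mat_interface_code:
  "block3_mat (3 ^ k) Bs $$ (interface_code (Suc k) P Q, interface_code (Suc k) Q' R) =
    (Bs ! (if Suc k \<in> Q then 0 else if Suc k \<in> P then 2 else 1)
        ! (if Suc k \<in> R then 0 else if Suc k \<in> Q' then 2 else 1))
      $$ (interface_code k P Q, interface_code k Q' R)"
  using interface_code_less[of "Suc k" P Q] interface_code_less[of "Suc k" Q' R]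
  by (simp add: block3_mat_def interface_code_div interface_code_mod
      del: interface_code.simps)

lemma carrier_block3_mat: "block3_mat N Bs \<in> carrier_mat (3 * N) (3 * N)"
  by (simp add: block3_mat_def)

lemma carrier_A_mat: "A_mat k \<in> carrier_mat (3 ^ k) (3 ^ k)"
  and carrier_B_mat: "B_mat k \<in> carrier_mat (3 ^ k) (3 ^ k)"
  and carrier_C_mat: "C_mat k \<in> carrier_mat (3 ^ k) (3 ^ k)"
  by (cases k; simp add: carrier_block3_mat mat_of_rows_list_def)+

text \<open>
  The three claims need each other.  Peeling off row \<open>k + 1\<close> leaves the rows \<open>1..k\<close> with row
  \<open>k + 1\<close> as their upper neighbour.  If row \<open>k + 1\<close> is selected, only digits \<open>0\<close> and \<open>2\<close> are possible
  and the rest is read off \<open>C_mat k\<close>; otherwise \<open>k + 1 \<notin> Q\<close> and the rest is a sum of \<open>A_mat k\<close> and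
  \<open>B_mat k\<close>, of which at most one is nonzero.  The single middle block \<open>A_mat k\<close> in \<open>B_mat (k + 1)\<close>
  is the case in which row \<open>k + 1\<close> has no selected neighbour to the left, to the right or in row
  \<open>k + 2\<close>, so that row \<open>k\<close> must be selected.  The hypothesis \<open>0 \<notin> Q\<close> says that
  there is no row below row \<open>1\<close>, which agrees with \<open>A_mat 0\<close> being zero.
\<close>
lemma ABC_mat_interface_code:
  assumes "0 \<notin> Q" "P \<inter> Q = {}" "Q' \<inter> R = {}"
  shows A_mat_interface_code: "Suc k \<notin> Q \<Longrightarrow>
      A_mat k $$ (interface_code k P Q, interface_code k Q' R) =
        (if k \<in> Q then column_weight k P Q Q' R else 0)"
    and B_mat_interface_code: "Suc k \<notin> Q \<Longrightarrow>
      B_mat k $$ (interface_code k P Q, interface_code k Q' R) =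
        (if k \<in> Q then 0 else column_weight k P Q Q' R)"
    and C_mat_interface_code: "Suc k \<in> Q \<Longrightarrow>
      C_mat k $$ (interface_code k P Q, interface_code k Q' R) = column_weight k P Q Q' R"
proof (induction k)
  case 0
  {
    case 1
    then show ?case using assms by (simp add: mat_of_rows_list_def)
  next
    case 2
    then show ?case using assms by (simp add: mat_of_rows_list_def column_weight_0)
  next
    case 3
    then show ?case by (simp add: mat_of_rows_list_def column_weight_0)
  }
next
  case (Suc k)
  have less: "interface_code k P Q < 3 ^ k" "interface_code k Q' R < 3 ^ k"
    by (rule interface_code_less)+
  note dims = carrier_matD[OF carrier_A_mat[of k]] carrier_matD[OF carrier_B_mat[of k]]
    carrier_matD[OF carrier_C_mat[of k]]
  note rules = block3_mat_interface_code column_weight_Suc less dims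
  {
    case 1
    then show ?case
      using Suc.IH assms by (auto simp: rules simp del: interface_code.simps)
  next
    case 2
    then show ?case
      using Suc.IH assms by (auto simp: rules simp del: interface_code.simps)
  next
    case 3
    then show ?case
      using Suc.IH assms by (auto simp: rules simp del: interface_code.simps)
  }
qed

lemma transfer_mat_interface_code:
  assumes "(P, Q) \<in> interfaces m" "(Q', R) \<in> interfaces m"
  shows "(A_mat m + B_mat m) $$ (interface_code m P Q, interface_code m Q' R) =
    (if Q = Q' \<and> column_ok m P Q R then monom 1 (card Q) else 0)"
proof -
  have Q: "0 \<notin> Q" "Suc m \<notin> Q" "P \<inter> Q = {}" "Q' \<inter> R = {}" "Q \<inter> {1..m} = Q" "Q' \<inter> {1..m} = Q'"
    using assms by (auto simp: interfaces_def)
  have "(A_mat m + B_mat m) $$ (interface_code m P Q, interface_code m Q' R) =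
      A_mat m $$ (interface_code m P Q, interface_code m Q' R) +
      B_mat m $$ (interface_code m P Q, interface_code m Q' R)"
    using carrier_B_mat[of m] interface_code_less[of m] by (intro index_add_mat) auto
  also have "\<dots> = column_weight m P Q Q' R"
    using Q by (simp add: A_mat_interface_code B_mat_interface_code)
  finally show ?thesis
    unfolding column_weight_def Q(5,6) .
qed

lemma carrier_D_mat: "D_mat m \<in> carrier_mat 1 (3 ^ m)"
  by (induction m) (auto simp: D_mat_def kronecker_product_def mat_of_rows_list_def)

lemma carrier_E_mat: "E_mat m \<in> carrier_mat (3 ^ m) 1"
  by (induction m) (auto simp: E_mat_def kronecker_product_def mat_of_rows_list_def)

lemma D_mat_interface_code:
  assumes "P \<inter> Q = {}"
  shows "D_mat m $$ (0, interface_code m P Q) = (if P \<inter> {1..m} = {} then 1 else 0)"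
proof (induction m)
  case 0
  then show ?case by (simp add: D_mat_def)
next
  case (Suc m)
  have D: "D_mat (Suc m) = mat_of_rows_list 3 [[1, 1, 0]] \<otimes>\<^sub>m D_mat m"
    by (simp add: D_mat_def)
  have "P \<inter> {1..Suc m} = {} \<longleftrightarrow> Suc m \<notin> P \<and> P \<inter> {1..m} = {}"
    by (auto simp: set_eq_iff le_Suc_eq)
  then show ?case
    using carrier_matD[OF carrier_D_mat[of m]] interface_code_less[of "Suc m" P Q] Suc.IH assms
    unfolding D kronecker_product_def
    by (auto simp: interface_code_div interface_code_mod mat_of_rows_list_def
        simp del: interface_code.simps)
qed

lemma E_mat_interface_code:
  "E_mat m $$ (interface_code m P Q, 0) = (if Q \<inter> {1..m} = {} then 1 else 0)"
proof (induction m)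
  case 0
  then show ?case by (simp add: E_mat_def)
next
  case (Suc m)
  have E: "E_mat (Suc m) = mat_of_rows_list 1 [[0], [1], [1]] \<otimes>\<^sub>m E_mat m"
    by (simp add: E_mat_def)
  have "Q \<inter> {1..Suc m} = {} \<longleftrightarrow> Suc m \<notin> Q \<and> Q \<inter> {1..m} = {}"
    by (auto simp: set_eq_iff le_Suc_eq)
  then show ?case
    using carrier_matD[OF carrier_E_mat[of m]] interface_code_less[of "Suc m" P Q] Suc.IH
    unfolding E kronecker_product_def
    by (auto simp: interface_code_div interface_code_mod mat_of_rows_list_def
        simp del: interface_code.simps)
qed

section \<open>Powers of the transfer matrix as sums over column sequences\<close>
lemma mult_mat_interfaces:
  assumes "X \<in> carrier_mat 1 (3 ^ m)" "Y \<in> carrier_mat (3 ^ m) c" "j < c"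
  shows "(X * Y) $$ (0, j) =
    (\<Sum>(P, Q)\<in>interfaces m. X $$ (0, interface_code m P Q) * Y $$ (interface_code m P Q, j))"
proof -
  have "(X * Y) $$ (0, j) = (\<Sum>i\<in>{0..<3 ^ m}. X $$ (0, i) * Y $$ (i, j))"
    using assms by (simp add: scalar_prod_def)
  also have "\<dots> = (\<Sum>p\<in>interfaces m. X $$ (0, case p of (P, Q) \<Rightarrow> interface_code m P Q) *
      Y $$ (case p of (P, Q) \<Rightarrow> interface_code m P Q, j))"
    by (rule sum.reindex_bij_betw[OF bij_betw_interface_code, symmetric])
  finally show ?thesis
    by (simp add: case_prod_beta)
qed

text \<open>
  Columns \<open>1..n\<close> are final here, while column \<open>n + 1\<close> is only announced: it can dominate cells of
  column \<open>n\<close>, but its own cells are neither tested nor weighed until it has a right neighbour.  Setting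
  the columns beyond \<open>n + 1\<close> to \<open>{}\<close> makes a sequence determined by its relevant part.
\<close>
definition admissible :: "nat \<Rightarrow> nat \<Rightarrow> (nat \<Rightarrow> nat set) set" where
  "admissible m n = {F. (\<forall>j. F j \<subseteq> {1..m}) \<and> F 0 = {} \<and> (\<forall>j>Suc n. F j = {}) \<and>
    (\<forall>j\<le>n. F j \<inter> F (Suc j) = {}) \<and>
    (\<forall>j<n. column_ok m (F j) (F (Suc j)) (F (Suc (Suc j))))}"

lemma finite_admissible: "finite (admissible m n)"
proof (rule finite_subset)
  show "admissible m n \<subseteq>
      {F. \<forall>j. (j \<in> {..Suc n} \<longrightarrow> F j \<in> Pow {1..m}) \<and> (j \<notin> {..Suc n} \<longrightarrow> F j = {})}"
    by (auto simp: admissible_def)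
qed (intro finite_set_of_finite_funs; simp)

lemma admissible_interface:
  assumes "F \<in> admissible m n"
  shows "(F n, F (Suc n)) \<in> interfaces m"
  using assms by (auto simp: admissible_def interfaces_def)

abbreviation column_sizes :: "nat \<Rightarrow> (nat \<Rightarrow> nat set) \<Rightarrow> nat" where
  "column_sizes n F \<equiv> \<Sum>j\<in>{1..n}. card (F j)"

text \<open>
  Summing over the last cut and then over the sequences with that cut is summing over all sequences;
  this turns a matrix product indexed by cuts into a single sum.
\<close>
lemma sum_admissible_by_interface:
  fixes h :: "nat set \<Rightarrow> nat set \<Rightarrow> 'a::comm_semiring_1"
  shows "(\<Sum>(P, Q)\<in>interfaces m. (\<Sum>F | F \<in> admissible m n \<and> F n = P \<and> F (Suc n) = Q. w F) * h P Q)
    = (\<Sum>F\<in>admissible m n. w F * h (F n) (F (Suc n)))"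
proof -
  have "(\<Sum>F\<in>admissible m n. w F * h (F n) (F (Suc n))) =
      (\<Sum>p\<in>interfaces m. \<Sum>F | F \<in> admissible m n \<and> (F n, F (Suc n)) = p.
        w F * h (F n) (F (Suc n)))"
    using admissible_interface
    by (intro sum.group[symmetric]) (auto simp: finite_admissible finite_interfaces)
  then show ?thesis
    by (auto simp: sum_distrib_right intro!: sum.cong)
qed

text \<open>
  Announcing column \<open>n + 2\<close> finalises column \<open>n + 1\<close>: the only new conditions are the test of that
  column and its disjointness from \<open>R\<close>.
\<close>
lemma bij_betw_extend_admissible:
  assumes "(Q, R) \<in> interfaces m"
  shows "bij_betw (\<lambda>F. F(Suc (Suc n) := R))
    {F \<in> admissible m n. F (Suc n) = Q \<and> column_ok m (F n) Q R}
    {F \<in> admissible m (Suc n). F (Suc n) = Q \<and> F (Suc (Suc n)) = R}"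
proof (rule bij_betw_byWitness[where f' = "\<lambda>F. F(Suc (Suc n) := {})"])
  show "(\<lambda>F. F(Suc (Suc n) := R)) ` {F \<in> admissible m n. F (Suc n) = Q \<and> column_ok m (F n) Q R}
      \<subseteq> {F \<in> admissible m (Suc n). F (Suc n) = Q \<and> F (Suc (Suc n)) = R}"
  proof clarify
    fix F assume F: "F \<in> admissible m n" "column_ok m (F n) (F (Suc n)) R" "Q = F (Suc n)"
    let ?G = "F(Suc (Suc n) := R)"
    have "?G j \<inter> ?G (Suc j) = {}" if "j \<le> Suc n" for j
      using that F assms by (cases "j = Suc n") (simp_all add: admissible_def interfaces_def)
    moreover have "column_ok m (?G j) (?G (Suc j)) (?G (Suc (Suc j)))" if "j < Suc n" for j
      using that F by (cases "j = n") (simp_all add: admissible_def)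
    ultimately show "?G \<in> admissible m (Suc n) \<and> ?G (Suc n) = F (Suc n) \<and> ?G (Suc (Suc n)) = R"
      using F(1) assms by (simp add: admissible_def interfaces_def)
  qed
  show "(\<lambda>F. F(Suc (Suc n) := {})) ` {F \<in> admissible m (Suc n). F (Suc n) = Q \<and> F (Suc (Suc n)) = R}
      \<subseteq> {F \<in> admissible m n. F (Suc n) = Q \<and> column_ok m (F n) Q R}"
  proof clarify
    fix F assume F: "F \<in> admissible m (Suc n)"
    let ?G = "F(Suc (Suc n) := {})"
    have "?G j = {}" if "j > Suc n" for j
      using that F by (cases "j = Suc (Suc n)") (simp_all add: admissible_def)
    moreover have "column_ok m (?G j) (?G (Suc j)) (?G (Suc (Suc j)))" if "j < n" for j
      using that F by (simp add: admissible_def)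
    ultimately have "?G \<in> admissible m n"
      using F by (simp add: admissible_def)
    moreover have "column_ok m (F n) (F (Suc n)) (F (Suc (Suc n)))"
      using F by (simp add: admissible_def)
    ultimately show "?G \<in> admissible m n \<and> ?G (Suc n) = F (Suc n) \<and>
        column_ok m (?G n) (F (Suc n)) (F (Suc (Suc n)))"
      by simp
  qed
  have "F (Suc (Suc n)) = {}" if "F \<in> admissible m n" for F
    using that by (simp add: admissible_def)
  then show "\<forall>F\<in>{F \<in> admissible m n. F (Suc n) = Q \<and> column_ok m (F n) Q R}.
      F(Suc (Suc n) := R, Suc (Suc n) := {}) = F"
    by (simp add: fun_upd_idem)
qed auto

text \<open>
  The row vector after \<open>n\<close> steps lists the generating polynomials of admissible sequences by their last
  cut.  At \<open>n = 0\<close> the sequence is determined by the announced first column, and the column before it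
  is empty, which is what \<open>D_mat m\<close> tests.
\<close>
lemma transfer_mat_power:
  assumes "(P, Q) \<in> interfaces m"
  shows "(D_mat m * (A_mat m + B_mat m) ^\<^sub>m n) $$ (0, interface_code m P Q) =
    (\<Sum>F | F \<in> admissible m n \<and> F n = P \<and> F (Suc n) = Q. monom 1 (column_sizes n F))"
  using assms
proof (induction n arbitrary: P Q)
  case 0
  define F\<^sub>0 :: "nat \<Rightarrow> nat set" where "F\<^sub>0 = (\<lambda>_. {})(Suc 0 := Q)"
  have F\<^sub>0: "F\<^sub>0 0 = {}" "F\<^sub>0 (Suc 0) = Q" "F\<^sub>0 \<in> admissible m 0"
    using 0 by (simp_all add: F\<^sub>0_def admissible_def interfaces_def)
  have unique: "F = F\<^sub>0" if "F \<in> admissible m 0" "F (Suc 0) = Q" for F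
  proof
    fix j
    show "F j = F\<^sub>0 j"
      using that by (cases "j = 0 \<or> j = Suc 0") (auto simp: admissible_def F\<^sub>0_def)
  qed
  have "F \<in> admissible m 0 \<and> F 0 = P \<and> F (Suc 0) = Q \<longleftrightarrow> P = {} \<and> F = F\<^sub>0" for F
    using F\<^sub>0 unique by metis
  then have eq: "{F. F \<in> admissible m 0 \<and> F 0 = P \<and> F (Suc 0) = Q} =
      (if P = {} then {F\<^sub>0} else {})"
    by simp
  have "P \<inter> {1..m} = P" "P \<inter> Q = {}"
    using 0 by (auto simp: interfaces_def)
  then show ?case
    using carrier_D_mat[of m] carrier_A_mat[of m] carrier_B_mat[of m]
    by (simp add: eq D_mat_interface_code)
next
  case (Suc n)
  let ?T = "A_mat m + B_mat m"
  have T: "?T \<in> carrier_mat (3 ^ m) (3 ^ m)"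
    using carrier_B_mat[of m] by simp
  have "(D_mat m * ?T ^\<^sub>m Suc n) $$ (0, interface_code m P Q) =
      ((D_mat m * ?T ^\<^sub>m n) * ?T) $$ (0, interface_code m P Q)"
    using carrier_D_mat[of m] T by (simp add: assoc_mult_mat[OF _ pow_carrier_mat])
  also have "\<dots> = (\<Sum>(P', Q')\<in>interfaces m.
      (D_mat m * ?T ^\<^sub>m n) $$ (0, interface_code m P' Q') *
        ?T $$ (interface_code m P' Q', interface_code m P Q))"
    using carrier_D_mat[of m] T interface_code_less[of m P Q]
    by (intro mult_mat_interfaces) (auto intro!: mult_carrier_mat pow_carrier_mat)
  also have "\<dots> = (\<Sum>(P', Q')\<in>interfaces m.
      (\<Sum>F | F \<in> admissible m n \<and> F n = P' \<and> F (Suc n) = Q'. monom 1 (column_sizes n F)) *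
        (if Q' = P \<and> column_ok m P' Q' Q then monom 1 (card Q') else 0))"
    using Suc.prems
    by (intro sum.cong refl) (auto simp: Suc.IH transfer_mat_interface_code simp del: index_add_mat)
  also have "\<dots> = (\<Sum>F\<in>admissible m n. monom 1 (column_sizes n F) *
      (if F (Suc n) = P \<and> column_ok m (F n) (F (Suc n)) Q then monom 1 (card (F (Suc n))) else 0))"
    by (rule sum_admissible_by_interface)
  also have "\<dots> = (\<Sum>F | F \<in> admissible m n \<and> F (Suc n) = P \<and> column_ok m (F n) P Q.
      monom 1 (column_sizes (Suc n) (F(Suc (Suc n) := Q))))"
    by (rule sum.mono_neutral_cong_right)
      (auto simp: finite_admissible mult_monom intro!: arg_cong[of _ _ "monom 1"])
  also have "\<dots> = (\<Sum>F | F \<in> admissible m (Suc n) \<and> F (Suc n) = P \<and> F (Suc (Suc n)) = Q.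
      monom 1 (column_sizes (Suc n) F))"
    by (rule sum.reindex_bij_betw[OF bij_betw_extend_admissible[OF Suc.prems]])
  finally show ?case .
qed

lemma transfer_product_eq_sum:
  "(D_mat m * (A_mat m + B_mat m) ^\<^sub>m n * E_mat m) $$ (0, 0) =
    (\<Sum>F | F \<in> admissible m n \<and> F (Suc n) = {}. monom 1 (column_sizes n F))"
proof -
  let ?T = "A_mat m + B_mat m"
  have T: "?T \<in> carrier_mat (3 ^ m) (3 ^ m)"
    using carrier_B_mat[of m] by simp
  have "(D_mat m * ?T ^\<^sub>m n * E_mat m) $$ (0, 0) = (\<Sum>(P, Q)\<in>interfaces m.
      (D_mat m * ?T ^\<^sub>m n) $$ (0, interface_code m P Q) * E_mat m $$ (interface_code m P Q, 0))"
    using carrier_D_mat[of m] carrier_E_mat[of m] T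
    by (intro mult_mat_interfaces) (auto intro!: mult_carrier_mat pow_carrier_mat)
  also have "\<dots> = (\<Sum>(P, Q)\<in>interfaces m.
      (\<Sum>F | F \<in> admissible m n \<and> F n = P \<and> F (Suc n) = Q. monom 1 (column_sizes n F)) *
        (if Q = {} then 1 else 0))"
  proof (intro sum.cong refl, clarify)
    fix P Q assume PQ: "(P, Q) \<in> interfaces m"
    then have "Q \<inter> {1..m} = Q" by (auto simp: interfaces_def)
    with PQ show "(D_mat m * ?T ^\<^sub>m n) $$ (0, interface_code m P Q) *
        E_mat m $$ (interface_code m P Q, 0) =
      (\<Sum>F | F \<in> admissible m n \<and> F n = P \<and> F (Suc n) = Q. monom 1 (column_sizes n F)) *
        (if Q = {} then 1 else 0)"
      by (simp only: transfer_mat_power E_mat_interface_code)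
  qed
  also have "\<dots> = (\<Sum>F\<in>admissible m n. monom 1 (column_sizes n F) *
      (if F (Suc n) = {} then 1 else 0))"
    by (rule sum_admissible_by_interface)
  also have "\<dots> = (\<Sum>F | F \<in> admissible m n \<and> F (Suc n) = {}. monom 1 (column_sizes n F))"
    by (rule sum.mono_neutral_cong_right) (auto simp: finite_admissible)
  finally show ?thesis .
qed

section \<open>Maximal independent sets of the grid\<close>

text \<open>
  An independent set is maximal iff no single vertex can be added, and in a loop-free symmetric graph
  a vertex can be added iff it has no neighbour in the set.
\<close>
lemma maximal_independent_vset_iff_dominating:
  assumes "pair_graph G"
  shows "maximal_independent_vset G S \<longleftrightarrow>
    independent_vset G S \<and> (\<forall>v\<in>pverts G - S. \<exists>u\<in>S. (u, v) \<in> parcs G)"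
proof -
  interpret pair_graph G by fact
  have loopfree: "(v, v) \<notin> parcs G" for v
    using no_loops'[of v v] by auto
  have sym: "(v, u) \<in> parcs G" if "(u, v) \<in> parcs G" for u v
    using that by (rule arcs_symmetric)
  show ?thesis
  proof (intro iffI conjI ballI)
    assume max: "maximal_independent_vset G S"
    then show ind: "independent_vset G S"
      by (simp add: maximal_independent_vset_def)
    fix v assume v: "v \<in> pverts G - S"
    then have "\<not> independent_vset G (insert v S)"
      using max by (auto simp: maximal_independent_vset_def)
    with v ind show "\<exists>u\<in>S. (u, v) \<in> parcs G"
      using loopfree sym by (auto simp: independent_vset_def)
  next
    assume *: "independent_vset G S \<and> (\<forall>v\<in>pverts G - S. \<exists>u\<in>S. (u, v) \<in> parcs G)"
    show "maximal_independent_vset G S"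
      unfolding maximal_independent_vset_def
    proof (intro conjI notI)
      assume "\<exists>T. independent_vset G T \<and> S \<subset> T"
      then obtain T v where "independent_vset G T" "S \<subset> T" "v \<in> T" "v \<notin> S" by blast
      with * show False
        unfolding independent_vset_def by blast
    qed (use * in simp)
  qed
qed

lemma parcs_grid_graph_iff:
  "((i, j), (k, l)) \<in> parcs (grid_graph m n) \<longleftrightarrow>
    (i, j) \<in> {1..m} \<times> {1..n} \<and> (k, l) \<in> {1..m} \<times> {1..n} \<and>
    (i = k \<and> (l = Suc j \<or> j = Suc l) \<or> j = l \<and> (k = Suc i \<or> i = Suc k))"
proof -
  have "\<bar>int a - int b\<bar> = 1 \<longleftrightarrow> b = Suc a \<or> a = Suc b" for a b
    by arith
  then show ?thesis
    by (simp add: grid_graph_def)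
qed

lemma independent_vset_grid_graph_iff:
  "independent_vset (grid_graph m n) S \<longleftrightarrow> S \<subseteq> {1..m} \<times> {1..n} \<and>
    (\<forall>(r, j)\<in>S. (Suc r, j) \<notin> S \<and> (r, Suc j) \<notin> S)"
proof (intro iffI conjI)
  assume ind: "independent_vset (grid_graph m n) S"
  then show sub: "S \<subseteq> {1..m} \<times> {1..n}"
    by (simp add: independent_vset_def grid_graph_def)
  show "\<forall>(r, j)\<in>S. (Suc r, j) \<notin> S \<and> (r, Suc j) \<notin> S"
  proof (clarify, intro conjI notI)
    fix r j assume "(r, j) \<in> S" "(Suc r, j) \<in> S"
    moreover from this have "((r, j), (Suc r, j)) \<in> parcs (grid_graph m n)"
      using sub by (auto simp: parcs_grid_graph_iff)
    ultimately show False using ind by (auto simp: independent_vset_def)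
  next
    fix r j assume "(r, j) \<in> S" "(r, Suc j) \<in> S"
    moreover from this have "((r, j), (r, Suc j)) \<in> parcs (grid_graph m n)"
      using sub by (auto simp: parcs_grid_graph_iff)
    ultimately show False using ind by (auto simp: independent_vset_def)
  qed
next
  assume *: "S \<subseteq> {1..m} \<times> {1..n} \<and> (\<forall>(r, j)\<in>S. (Suc r, j) \<notin> S \<and> (r, Suc j) \<notin> S)"
  then have "((i, j), (k, l)) \<notin> parcs (grid_graph m n)" if "(i, j) \<in> S" "(k, l) \<in> S" for i j k l
    using that by (auto simp: parcs_grid_graph_iff)
  with * show "independent_vset (grid_graph m n) S"
    by (auto simp: independent_vset_def grid_graph_def[THEN arg_cong[of _ _ pverts]])
qed

text \<open>
  The four neighbours are written down without checking that they lie in the grid, which is harmless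
  because \<open>S\<close> does; in particular \<open>j - 1 = 0\<close> and \<open>r - 1 = 0\<close> give no element of \<open>S\<close>.
\<close>
lemma dominating_grid_graph_iff:
  assumes "S \<subseteq> {1..m} \<times> {1..n}"
  shows "(\<forall>v\<in>pverts (grid_graph m n) - S. \<exists>u\<in>S. (u, v) \<in> parcs (grid_graph m n)) \<longleftrightarrow>
    (\<forall>r\<in>{1..m}. \<forall>j\<in>{1..n}. (r, j) \<in> S \<or>
      (r, j - 1) \<in> S \<or> (r, Suc j) \<in> S \<or> (r - 1, j) \<in> S \<or> (Suc r, j) \<in> S)"
proof -
  have verts: "pverts (grid_graph m n) = {1..m} \<times> {1..n}"
    by (simp add: grid_graph_def)
  have "(\<exists>u\<in>S. (u, (r, j)) \<in> parcs (grid_graph m n)) \<longleftrightarrow>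
      (r, j - 1) \<in> S \<or> (r, Suc j) \<in> S \<or> (r - 1, j) \<in> S \<or> (Suc r, j) \<in> S" (is "?L \<longleftrightarrow> ?R")
    if "r \<in> {1..m}" "j \<in> {1..n}" for r j
  proof
    assume ?L
    then show ?R by (auto simp: parcs_grid_graph_iff)
  next
    have "(u, (r, j)) \<in> parcs (grid_graph m n)"
      if "u \<in> S" "u \<in> {(r, j - 1), (r, Suc j), (r - 1, j), (Suc r, j)}" for u
      using that assms \<open>r \<in> {1..m}\<close> \<open>j \<in> {1..n}\<close> by (auto simp: parcs_grid_graph_iff)
    moreover assume ?R
    ultimately show ?L by blast
  qed
  then show ?thesis
    unfolding verts by blast
qed

text \<open>
  Column by column, independence and domination become the conditions of \<open>admissible\<close>: vertical
  edges and domination are the test \<open>column_ok\<close>, horizontal edges the disjointness of consecutive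
  columns.  The announced column \<open>n + 1\<close> has to be empty, as there are no vertices in it.
\<close>
lemma bij_betw_admissible_mis:
  "bij_betw (\<lambda>F. {(r, j). r \<in> F j}) {F \<in> admissible m n. F (Suc n) = {}}
    {S. maximal_independent_vset (grid_graph m n) S}"
proof (rule bij_betw_byWitness[where f' = "\<lambda>S j. {r. (r, j) \<in> S}"])
  have mis_iff: "maximal_independent_vset (grid_graph m n) S \<longleftrightarrow>
      S \<subseteq> {1..m} \<times> {1..n} \<and> (\<forall>(r, j)\<in>S. (Suc r, j) \<notin> S \<and> (r, Suc j) \<notin> S) \<and>
      (\<forall>r\<in>{1..m}. \<forall>j\<in>{1..n}. (r, j) \<in> S \<or>
        (r, j - 1) \<in> S \<or> (r, Suc j) \<in> S \<or> (r - 1, j) \<in> S \<or> (Suc r, j) \<in> S)" for S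
    unfolding maximal_independent_vset_iff_dominating[OF pair_graph_grid_graph]
      independent_vset_grid_graph_iff
    by (simp only: conj_assoc dominating_grid_graph_iff cong: conj_cong)
  show "(\<lambda>F. {(r, j). r \<in> F j}) ` {F \<in> admissible m n. F (Suc n) = {}}
      \<subseteq> {S. maximal_independent_vset (grid_graph m n) S}"
  proof clarify
    fix F assume F: "F \<in> admissible m n" "F (Suc n) = {}"
    have outside: "F j = {}" if "j \<notin> {1..n}" for j
    proof -
      from that have "j = 0 \<or> j = Suc n \<or> Suc n < j" by auto
      with F show ?thesis by (auto simp: admissible_def)
    qed
    have rows: "F j \<subseteq> {1..m}" for j
      using F by (simp add: admissible_def)
    have ok: "column_ok m (F (j - 1)) (F j) (F (Suc j))" if "j \<in> {1..n}" for j
      using F that by (cases j) (auto simp: admissible_def)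
    have disj: "F j \<inter> F (Suc j) = {}" for j
      using F outside by (cases "j \<le> n") (auto simp: admissible_def)
    have sub: "{(r, j). r \<in> F j} \<subseteq> {1..m} \<times> {1..n}"
      using outside rows by blast
    have ind: "Suc r \<notin> F j \<and> r \<notin> F (Suc j)" if "r \<in> F j" for r j
    proof -
      have "r \<in> {1..m}" "j \<in> {1..n}" using that sub by auto
      with bspec[OF ok[unfolded column_ok_def], of j r] that disj[of j] show ?thesis by auto
    qed
    have dom: "r \<in> F j \<or> r \<in> F (j - 1) \<or> r \<in> F (Suc j) \<or> r - 1 \<in> F j \<or> Suc r \<in> F j"
      if "r \<in> {1..m}" "j \<in> {1..n}" for r j
      using bspec[OF ok[OF that(2), unfolded column_ok_def] that(1)] by argo
    show "maximal_independent_vset (grid_graph m n) {(r, j). r \<in> F j}"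
      unfolding mis_iff using sub ind dom by simp
  qed
  show "(\<lambda>S j. {r. (r, j) \<in> S}) ` {S. maximal_independent_vset (grid_graph m n) S}
      \<subseteq> {F \<in> admissible m n. F (Suc n) = {}}"
  proof (clarify, intro conjI)
    fix S assume "maximal_independent_vset (grid_graph m n) S"
    then have sub: "S \<subseteq> {1..m} \<times> {1..n}"
      and ind: "\<And>r j. (r, j) \<in> S \<Longrightarrow> (Suc r, j) \<notin> S \<and> (r, Suc j) \<notin> S"
      and dom: "\<And>r j. r \<in> {1..m} \<Longrightarrow> j \<in> {1..n} \<Longrightarrow> (r, j) \<in> S \<or>
        (r, j - 1) \<in> S \<or> (r, Suc j) \<in> S \<or> (r - 1, j) \<in> S \<or> (Suc r, j) \<in> S"
      unfolding mis_iff by auto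
    show "{r. (r, Suc n) \<in> S} = {}"
      using sub by auto
    have "column_ok m {r. (r, j) \<in> S} {r. (r, Suc j) \<in> S} {r. (r, Suc (Suc j)) \<in> S}"
      if "j < n" for j
      unfolding column_ok_def
    proof
      fix r assume "r \<in> {1..m}"
      with dom[of r "Suc j"] ind[of r "Suc j"] that
      show "if r \<in> {r. (r, Suc j) \<in> S} then Suc r \<notin> {r. (r, Suc j) \<in> S}
        else r \<in> {r. (r, j) \<in> S} \<or> r \<in> {r. (r, Suc (Suc j)) \<in> S} \<or>
          r - 1 \<in> {r. (r, Suc j) \<in> S} \<or> Suc r \<in> {r. (r, Suc j) \<in> S}"
        by auto
    qed
    then show "(\<lambda>j. {r. (r, j) \<in> S}) \<in> admissible m n"
      using sub ind by (fastforce simp: admissible_def)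
  qed
qed auto

lemma card_columns_union:
  assumes "F \<in> admissible m n" "F (Suc n) = {}"
  shows "card {(r, j). r \<in> F j} = column_sizes n F"
proof -
  have fin: "finite (F j)" for j
    using assms(1) finite_subset[of "F j" "{1..m}"] by (auto simp: admissible_def)
  have "j \<in> {1..n}" if "r \<in> F j" for r j
  proof (rule ccontr)
    assume "j \<notin> {1..n}"
    then have "j = 0 \<or> j = Suc n \<or> Suc n < j" by auto
    with assms that show False by (auto simp: admissible_def)
  qed
  then have "{(r, j). r \<in> F j} = prod.swap ` (SIGMA j:{1..n}. F j)"
    by auto
  then have "card {(r, j). r \<in> F j} = card (SIGMA j:{1..n}. F j)"
    by (simp add: card_image)
  also have "\<dots> = column_sizes n F"
    using fin by (intro card_SigmaI) auto
  finally show ?thesis .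
qed

lemma mis_poly_eq_sum_mis:
  "mis_poly m n = (\<Sum>S | maximal_independent_vset (grid_graph m n) S. monom 1 (card S))"
proof (rule poly_eqI)
  fix t
  have "finite {S. maximal_independent_vset (grid_graph m n) S}"
    by (rule finite_subset[of _ "Pow ({1..m} \<times> {1..n})"])
      (auto simp: maximal_independent_vset_def independent_vset_def grid_graph_def)
  then show "coeff (mis_poly m n) t =
      coeff (\<Sum>S | maximal_independent_vset (grid_graph m n) S. monom 1 (card S)) t"
    by (simp add: coeff_mis_poly mis_count_def coeff_sum sum.If_cases Int_def)
qed

theorem theorem1:
  fixes m n :: nat
  assumes "m \<ge> 1" and "n \<ge> 1"
  shows "D_mat m * (A_mat m + B_mat m) ^\<^sub>m n * E_mat m \<in> carrier_mat 1 1 \<and>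
    mis_poly m n = (D_mat m * (A_mat m + B_mat m) ^\<^sub>m n * E_mat m) $$ (0, 0)"
proof
  show "D_mat m * (A_mat m + B_mat m) ^\<^sub>m n * E_mat m \<in> carrier_mat 1 1"
    using carrier_D_mat[of m] carrier_E_mat[of m] by auto
  have "mis_poly m n =
      (\<Sum>F | F \<in> admissible m n \<and> F (Suc n) = {}. monom 1 (card {(r, j). r \<in> F j}))"
    unfolding mis_poly_eq_sum_mis
    by (rule sum.reindex_bij_betw[OF bij_betw_admissible_mis, symmetric])
  also have "\<dots> = (\<Sum>F | F \<in> admissible m n \<and> F (Suc n) = {}. monom 1 (column_sizes n F))"
    by (intro sum.cong refl) (metis (mono_tags, lifting) mem_Collect_eq card_columns_union)
  also have "\<dots> = (D_mat m * (A_mat m + B_mat m) ^\<^sub>m n * E_mat m) $$ (0, 0)"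
    by (rule transfer_product_eq_sum[symmetric])
  finally show "mis_poly m n = (D_mat m * (A_mat m + B_mat m) ^\<^sub>m n * E_mat m) $$ (0, 0)" .
qed

end
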